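(* Let $H$ be a complex Hilbert lattice and let $A$ be a densely defined self-adjoint operator on $H$ such that $s(A)\in\mathbb{R}$ is an isolated point of $\sigma(A)$. Assume that $\ker(s(A)I-A)$ is one-dimensional and contains a non-zero positive vector. Then the resolvent $R(\cdot,A)$ is uniformly asymptotically positive at $s(A)$, and the semigroup $(e^{tA})_{t\ge0}$ is uniformly asymptotically positive.
   Context: A Hilbert lattice is a Banach lattice with norm induced by an inner product. $d_+(f)=\operatorname{dist}(f,H_+)$; $s(A)$ is the spectral bound. For a real spectral value $\lambda_0$ with $(\lambda_0,\lambda_0+\varepsilon]\subseteq\rho(A)$ and $\limsup_{\lambda\downarrow\lambda_0}\|(\lambda-\lambda_0)R(\lambda,A)\|<\infty$: $R(\cdot,A)$ is uniformly asymptotically positive at $\lambda_0$ if for each $\varepsilon>0$ there is $\lambda_1>\lambda_0$ with $(\lambda_0,\lambda_1]\subseteq\rho(A)$ and $(\lambda-\lambda_0)d_+(R(\lambda,A)f)\le\varepsilon\|f\|$ for all $f\in H_+$, $\lambda\in(\lambda_0,\lambda_1]$. A semigroup with $(e^{t(A-s(A))})$ bounded is uniformly asymptotically positive if for each $\varepsilon>0$ there is $t_0$ with $d_+(e^{t(A-s(A))}f)\le\varepsilon\|f\|$ for all $t\ge t_0$, $f\in H_+$. *)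

theory Defs
  imports "HOL-Analysis.Analysis"
begin

text \<open>A complex Hilbert lattice is modelled as the complexification E + iE of a real
Hilbert lattice E, represented as pairs (x, y) meaning x + i y.  The real Hilbert
lattice E is a type of class real_inner, complete_space, ordered_real_vector, lattice
whose norm is a lattice norm (stated in the theorem).  The product norm on pairs is
the complexified Hilbert norm.\<close>

definition cscale :: "complex \<Rightarrow> 'a::real_vector \<times> 'a \<Rightarrow> 'a \<times> 'a" where
  "cscale c f = (Re c *\<^sub>R fst f - Im c *\<^sub>R snd f, Re c *\<^sub>R snd f + Im c *\<^sub>R fst f)"

text \<open>Complex inner product, linear in the first argument.\<close>
definition cinner :: "'a::real_inner \<times> 'a \<Rightarrow> 'a \<times> 'a \<Rightarrow> complex" where
  "cinner f g = Complex (fst f \<bullet> fst g + snd f \<bullet> snd g) (snd f \<bullet> fst g - fst f \<bullet> snd g)"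

definition pos_cone :: "('a::{real_vector, order} \<times> 'a) set" where
  "pos_cone = {f. 0 \<le> fst f \<and> snd f = 0}"

definition d_plus :: "'a::{real_normed_vector, order} \<times> 'a \<Rightarrow> real" where
  "d_plus f = infdist f pos_cone"

definition complex_subspace :: "('a::real_vector \<times> 'a) set \<Rightarrow> bool" where
  "complex_subspace D \<longleftrightarrow> 0 \<in> D \<and> (\<forall>f\<in>D. \<forall>g\<in>D. f + g \<in> D) \<and> (\<forall>c. \<forall>f\<in>D. cscale c f \<in> D)"

definition clinear_op :: "('a::real_vector \<times> 'a) set \<Rightarrow> ('a \<times> 'a \<Rightarrow> 'a \<times> 'a) \<Rightarrow> bool" where
  "clinear_op D A \<longleftrightarrow> complex_subspace D \<and> (\<forall>f\<in>D. \<forall>g\<in>D. A (f + g) = A f + A g)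
     \<and> (\<forall>c. \<forall>f\<in>D. A (cscale c f) = cscale c (A f))"

text \<open>Self-adjointness A = A^*: A is symmetric, and D(A^*) is contained in D with A^* = A.\<close>
definition self_adjoint_op :: "('a::real_inner \<times> 'a) set \<Rightarrow> ('a \<times> 'a \<Rightarrow> 'a \<times> 'a) \<Rightarrow> bool" where
  "self_adjoint_op D A \<longleftrightarrow>
     (\<forall>f\<in>D. \<forall>g\<in>D. cinner (A f) g = cinner f (A g)) \<and>
     (\<forall>g h. (\<forall>f\<in>D. cinner (A f) g = cinner f h) \<longrightarrow> g \<in> D \<and> h = A g)"

definition resolvent_set :: "('a::real_normed_vector \<times> 'a) set \<Rightarrow> ('a \<times> 'a \<Rightarrow> 'a \<times> 'a) \<Rightarrow> complex set" where
  "resolvent_set D A = {z. (\<forall>f. \<exists>!u. u \<in> D \<and> cscale z u - A u = f) \<and>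
      (\<exists>C. \<forall>u\<in>D. norm u \<le> C * norm (cscale z u - A u))}"

definition spectrum_op :: "('a::real_normed_vector \<times> 'a) set \<Rightarrow> ('a \<times> 'a \<Rightarrow> 'a \<times> 'a) \<Rightarrow> complex set" where
  "spectrum_op D A = UNIV - resolvent_set D A"

definition resolvent :: "('a::real_normed_vector \<times> 'a) set \<Rightarrow> ('a \<times> 'a \<Rightarrow> 'a \<times> 'a) \<Rightarrow> complex \<Rightarrow> 'a \<times> 'a \<Rightarrow> 'a \<times> 'a" where
  "resolvent D A z f = (THE u. u \<in> D \<and> cscale z u - A u = f)"

text \<open>Spectral bound s(A) = sup Re sigma(A), in the extended reals (= -infinity for empty spectrum).\<close>
definition spectral_bound :: "('a::real_normed_vector \<times> 'a) set \<Rightarrow> ('a \<times> 'a \<Rightarrow> 'a \<times> 'a) \<Rightarrow> ereal" where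
  "spectral_bound D A = (SUP z\<in>spectrum_op D A. ereal (Re z))"

definition eigenspace_op :: "('a::real_vector \<times> 'a) set \<Rightarrow> ('a \<times> 'a \<Rightarrow> 'a \<times> 'a) \<Rightarrow> complex \<Rightarrow> ('a \<times> 'a) set" where
  "eigenspace_op D A \<mu> = {u \<in> D. cscale \<mu> u - A u = 0}"

definition one_dimensional :: "('a::real_vector \<times> 'a) set \<Rightarrow> bool" where
  "one_dimensional V \<longleftrightarrow> (\<exists>v. v \<noteq> 0 \<and> V = range (\<lambda>c. cscale c v))"

text \<open>Uniform asymptotic positivity of the resolvent at a real spectral value lambda0,
  including the standing requirements on lambda0.\<close>
definition resolvent_unif_asym_pos ::
  "('a::{real_normed_vector, order} \<times> 'a) set \<Rightarrow> ('a \<times> 'a \<Rightarrow> 'a \<times> 'a) \<Rightarrow> real \<Rightarrow> bool" where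
  "resolvent_unif_asym_pos D A l0 \<longleftrightarrow>
     complex_of_real l0 \<in> spectrum_op D A \<and>
     (\<exists>\<epsilon>>0. \<forall>l\<in>{l0<..l0+\<epsilon>}. complex_of_real l \<in> resolvent_set D A) \<and>
     Limsup (at_right l0) (\<lambda>l. ereal (onorm (\<lambda>f. (l - l0) *\<^sub>R resolvent D A (complex_of_real l) f))) < \<infinity> \<and>
     (\<forall>\<epsilon>>0. \<exists>l1>l0. (\<forall>l\<in>{l0<..l1}. complex_of_real l \<in> resolvent_set D A) \<and>
        (\<forall>f\<in>pos_cone. \<forall>l\<in>{l0<..l1}.
           (l - l0) * d_plus (resolvent D A (complex_of_real l) f) \<le> \<epsilon> * norm f))"

definition C0_semigroup :: "(real \<Rightarrow> 'a::real_normed_vector \<times> 'a \<Rightarrow> 'a \<times> 'a) \<Rightarrow> bool" where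
  "C0_semigroup T \<longleftrightarrow>
     (\<forall>t\<ge>0. bounded_linear (T t) \<and> (\<forall>c f. T t (cscale c f) = cscale c (T t f))) \<and>
     T 0 = id \<and> (\<forall>t\<ge>0. \<forall>s\<ge>0. T (t + s) = T t \<circ> T s) \<and>
     (\<forall>f. continuous_on {0..} (\<lambda>t. T t f))"

definition generates :: "(real \<Rightarrow> 'a::real_normed_vector \<times> 'a \<Rightarrow> 'a \<times> 'a) \<Rightarrow> ('a \<times> 'a) set \<Rightarrow> ('a \<times> 'a \<Rightarrow> 'a \<times> 'a) \<Rightarrow> bool" where
  "generates T D A \<longleftrightarrow> C0_semigroup T \<and>
     D = {f. \<exists>g. ((\<lambda>h. (1 / h) *\<^sub>R (T h f - f)) \<longlongrightarrow> g) (at_right 0)} \<and>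
     (\<forall>f\<in>D. ((\<lambda>h. (1 / h) *\<^sub>R (T h f - f)) \<longlongrightarrow> A f) (at_right 0))"

definition semigroup_unif_asym_pos :: "(real \<Rightarrow> 'a::{real_normed_vector, order} \<times> 'a \<Rightarrow> 'a \<times> 'a) \<Rightarrow> real \<Rightarrow> bool" where
  "semigroup_unif_asym_pos T s \<longleftrightarrow>
     (\<exists>M. \<forall>t\<ge>0. onorm (\<lambda>f. exp (- s * t) *\<^sub>R T t f) \<le> M) \<and>
     (\<forall>\<epsilon>>0. \<exists>t0\<ge>0. \<forall>t\<ge>t0. \<forall>f\<in>pos_cone. d_plus (exp (- s * t) *\<^sub>R T t f) \<le> \<epsilon> * norm f)"

end

(* H is viewed as a real Hilbert space. Put L = s - A and let (s - \<delta>, s + \<delta>) meet the spectrum only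
   at s. Instead of the spectral theorem, one uses that a symmetric resolvent is bounded by the
   inverse distance to the spectrum: this gives <L f, f> >= 0 and \<delta> <L f, f> <= |L f|^2, hence
   <L y, y> >= \<delta> |y|^2 for y = L f in D. Therefore F \<mu> x = \<mu> R(s + \<mu>) x converges with rate O(\<mu>) to a
   vector p of the kernel, while the energy estimate for t |-> |T t y|^2 on the range of L gives
   |T t (x - p)| <= 2 exp((s - \<delta>) t) |x|. Since p is the orthogonal projection of x onto the line
   spanned by a positive vector, and positive vectors have nonnegative inner product in a Hilbert
   lattice, p is positive whenever x is; so d_+ is bounded by the distance to p. *)

theory Submission
  imports Defs
begin

section \<open>Growth bounds from one-sided derivatives\<close>

text \<open>Subtracting \<open>\<epsilon> * \<tau>\<close> makes the right derivative strictly
  negative, so the tilted function falls just after the last point where it is nonpositive; that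
  point therefore cannot precede \<open>t\<close>. One-sided derivatives are what a semigroup
  generator supplies directly.\<close>

lemma right_deriv_nonpos_imp_le:
  fixes \<phi> :: "real \<Rightarrow> real"
  assumes cont: "continuous_on {0..} \<phi>"
    and der: "\<And>t. 0 \<le> t \<Longrightarrow> \<exists>d\<le>0. (\<phi> has_real_derivative d) (at_right t)"
    and t: "0 \<le> t"
  shows "\<phi> t \<le> \<phi> 0"
proof (rule field_le_epsilon)
  fix e :: real assume e: "0 < e"
  \<comment> \<open>The denominator \<open>t + 1\<close> covers the case
    \<open>t = 0\<close>.\<close>
  define \<epsilon> where "\<epsilon> = e / (t + 1)"
  have \<epsilon>: "\<epsilon> > 0" "\<epsilon> * t \<le> e" using e t by (auto simp: \<epsilon>_def field_simps)
  define \<psi> where "\<psi> \<tau> = \<phi> \<tau> - \<phi> 0 - \<epsilon> * \<tau>" for \<tau>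
  have "\<psi> t \<le> 0"
  proof (rule ccontr)
    assume "\<not> \<psi> t \<le> 0"
    hence pt: "\<psi> t > 0" by simp
    define E where "E = {\<tau> \<in> {0..t}. \<psi> \<tau> \<le> 0}"
    have contt: "continuous_on {0..t} \<psi>"
      unfolding \<psi>_def by (intro continuous_intros continuous_on_subset[OF cont]) auto
    have "closed E" unfolding E_def
      by (intro continuous_on_closed_Collect_le contt continuous_intros)
    moreover have "0 \<in> E" using t by (simp add: E_def \<psi>_def)
    moreover have bdd: "bdd_above E" by (rule bdd_aboveI[of _ t]) (auto simp: E_def)
    ultimately have SE: "Sup E \<in> E" by (intro closed_contains_Sup) auto
    \<comment> \<open>Last point of \<open>{0..t}\<close> at which \<open>\<psi>\<close> is
      nonpositive.\<close>
    define a where "a = Sup E"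
    have a: "0 \<le> a" "a < t" "\<psi> a \<le> 0"
      using SE pt by (auto simp: E_def a_def order_le_less)
    have pos: "\<psi> \<tau> > 0" if "a < \<tau>" "\<tau> \<le> t" for \<tau>
    proof (rule ccontr)
      assume "\<not> \<psi> \<tau> > 0"
      hence "\<tau> \<in> E" using that a by (auto simp: E_def)
      from cSup_upper[OF this bdd] show False using that by (simp add: a_def)
    qed
    obtain d where d: "d \<le> 0" "(\<phi> has_real_derivative d) (at_right a)" using der[OF a(1)] by auto
    have "(\<psi> has_real_derivative d - \<epsilon>) (at_right a)"
      unfolding \<psi>_def by (auto intro!: derivative_eq_intros d(2))
    from has_real_derivative_neg_dec_right[OF this] d \<epsilon>
    obtain r where r: "r > 0" "\<And>h. 0 < h \<Longrightarrow> a + h \<in> {a<..} \<Longrightarrow> h < r \<Longrightarrow> \<psi> (a + h) < \<psi> a"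
      by auto
    define h where "h = min (r/2) (t - a)"
    have "0 < h" "h < r" "a + h \<le> t" using r a by (auto simp: h_def min_def)
    with r(2)[of h] pos[of "a + h"] a(3) show False by simp
  qed
  thus "\<phi> t \<le> \<phi> 0 + e" using \<epsilon> by (simp add: \<psi>_def)
qed

text \<open>Gronwall in energy form: the squared norm times \<open>exp (- 2 * \<kappa> * t)\<close>
  has nonpositive right derivative.\<close>

lemma norm_le_exp_of_dissipative:
  fixes w w' :: "real \<Rightarrow> 'b::real_inner"
  assumes cont: "continuous_on {0..} w"
    and der: "\<And>t. 0 \<le> t \<Longrightarrow> (w has_vector_derivative w' t) (at_right t)"
    and diss: "\<And>t. 0 \<le> t \<Longrightarrow> w' t \<bullet> w t \<le> \<kappa> * (norm (w t))\<^sup>2"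
    and t: "0 \<le> t"
  shows "norm (w t) \<le> exp (\<kappa> * t) * norm (w 0)"
proof -
  define \<phi> where "\<phi> t = exp (- 2 * \<kappa> * t) * (w t \<bullet> w t)" for t
  have "\<phi> t \<le> \<phi> 0"
  proof (rule right_deriv_nonpos_imp_le[OF _ _ t])
    show "continuous_on {0..} \<phi>" unfolding \<phi>_def by (intro continuous_intros cont)
    fix t :: real assume t: "0 \<le> t"
    have wd: "(w has_derivative (\<lambda>h. h *\<^sub>R w' t)) (at_right t)"
      using der[OF t] by (simp add: has_vector_derivative_def)
    have "((\<lambda>t. w t \<bullet> w t) has_derivative (\<lambda>h. w t \<bullet> (h *\<^sub>R w' t) + (h *\<^sub>R w' t) \<bullet> w t)) (at_right t)"
      by (rule has_derivative_inner[OF wd wd])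
    hence "((\<lambda>t. w t \<bullet> w t) has_real_derivative (2 * (w' t \<bullet> w t))) (at_right t)"
      unfolding has_field_derivative_def
      by (rule has_derivative_eq_rhs) (simp add: fun_eq_iff inner_commute[of "w t"] mult.commute)
    moreover have "((\<lambda>t. exp (- 2 * \<kappa> * t)) has_real_derivative exp (- 2 * \<kappa> * t) * (- 2 * \<kappa>)) (at_right t)"
      by (auto intro!: derivative_eq_intros)
    ultimately have "(\<phi> has_real_derivative
       exp (- 2 * \<kappa> * t) * (2 * (w' t \<bullet> w t)) + exp (- 2 * \<kappa> * t) * (- 2 * \<kappa>) * (w t \<bullet> w t)) (at_right t)"
      unfolding \<phi>_def using DERIV_mult'[of "\<lambda>t. exp (- 2 * \<kappa> * t)"] by blast
    moreover have "exp (- 2 * \<kappa> * t) * (2 * (w' t \<bullet> w t)) + exp (- 2 * \<kappa> * t) * (- 2 * \<kappa>) * (w t \<bullet> w t)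
       = exp (- 2 * \<kappa> * t) * (2 * (w' t \<bullet> w t - \<kappa> * (norm (w t))\<^sup>2))"
      by (simp add: algebra_simps power2_norm_eq_inner)
    moreover have "\<dots> \<le> 0" using diss[OF t] by (intro mult_nonneg_nonpos) auto
    ultimately show "\<exists>d\<le>0. (\<phi> has_real_derivative d) (at_right t)" by metis
  qed
  hence "exp (- 2 * \<kappa> * t) * (norm (w t))\<^sup>2 \<le> (norm (w 0))\<^sup>2"
    by (simp add: \<phi>_def power2_norm_eq_inner)
  hence "exp (2 * \<kappa> * t) * (exp (- 2 * \<kappa> * t) * (norm (w t))\<^sup>2) \<le> exp (2 * \<kappa> * t) * (norm (w 0))\<^sup>2"
    by (intro mult_left_mono) auto
  moreover have "exp (2 * \<kappa> * t) * exp (- 2 * \<kappa> * t) = 1"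
    by (subst exp_add[symmetric]) simp
  hence "exp (2 * \<kappa> * t) * (exp (- 2 * \<kappa> * t) * (norm (w t))\<^sup>2) = (norm (w t))\<^sup>2"
    by (simp only: mult.assoc[symmetric] mult_1_left)
  moreover have "exp (2 * \<kappa> * t) * (norm (w 0))\<^sup>2 = (exp (\<kappa> * t) * norm (w 0))\<^sup>2"
    by (simp add: power_mult_distrib exp_double[symmetric] mult.assoc)
  ultimately have "(norm (w t))\<^sup>2 \<le> (exp (\<kappa> * t) * norm (w 0))\<^sup>2" by metis
  thus ?thesis by (rule power2_le_imp_le) simp
qed

section \<open>Symmetric operators and the distance to the spectrum\<close>

lemma norm_add_scaleR_squared:
  fixes a b :: "'b::real_inner"
  shows "(norm (a + c *\<^sub>R b))\<^sup>2 = (norm a)\<^sup>2 + 2 * c * (a \<bullet> b) + c\<^sup>2 * (norm b)\<^sup>2"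
  unfolding power2_norm_eq_inner
  by (simp add: inner_add_left inner_add_right inner_commute[of b a])
     (simp add: algebra_simps power2_eq_square)

text \<open>The complex space is treated as a real one: on pairs the real inner product is the real
  part of \<open>cinner\<close>. Below, \<open>regular\<close> and \<open>R\<close> are the
  resolvent set and the resolvent at real points.\<close>

locale symmetric_operator =
  fixes D :: "'b::real_inner set" and A :: "'b \<Rightarrow> 'b"
  assumes subsp: "subspace D"
    and add: "\<And>f g. f \<in> D \<Longrightarrow> g \<in> D \<Longrightarrow> A (f + g) = A f + A g"
    and scale: "\<And>c f. f \<in> D \<Longrightarrow> A (c *\<^sub>R f) = c *\<^sub>R A f"
    and sym: "\<And>f g. f \<in> D \<Longrightarrow> g \<in> D \<Longrightarrow> A f \<bullet> g = f \<bullet> A g"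
begin

definition regular :: "real \<Rightarrow> bool" where
  "regular z \<longleftrightarrow> (\<forall>f. \<exists>!u. u \<in> D \<and> z *\<^sub>R u - A u = f) \<and>
     (\<exists>C. \<forall>u\<in>D. norm u \<le> C * norm (z *\<^sub>R u - A u))"

definition R :: "real \<Rightarrow> 'b \<Rightarrow> 'b" where
  "R z f = (THE u. u \<in> D \<and> z *\<^sub>R u - A u = f)"

lemma D_closed [simp]:
  "f \<in> D \<Longrightarrow> g \<in> D \<Longrightarrow> f + g \<in> D" "f \<in> D \<Longrightarrow> g \<in> D \<Longrightarrow> f - g \<in> D" "f \<in> D \<Longrightarrow> c *\<^sub>R f \<in> D"
  using subsp by (auto simp: subspace_add subspace_diff subspace_scale)

lemma diff: "f \<in> D \<Longrightarrow> g \<in> D \<Longrightarrow> A (f - g) = A f - A g"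
  using add[of "f - g" g] by simp

lemma
  assumes "regular z"
  shows R_in_D: "R z f \<in> D" and R_eq: "z *\<^sub>R R z f - A (R z f) = f"
proof -
  have "\<exists>!u. u \<in> D \<and> z *\<^sub>R u - A u = f" using assms by (auto simp: regular_def)
  from theI'[OF this] show "R z f \<in> D" "z *\<^sub>R R z f - A (R z f) = f" by (auto simp: R_def)
qed

lemma R_unique: "regular z \<Longrightarrow> u \<in> D \<Longrightarrow> z *\<^sub>R u - A u = f \<Longrightarrow> R z f = u"
  unfolding R_def regular_def by (rule the1_equality) blast+

lemma regular_bound:
  assumes "regular z"
  obtains C where "C > 0" "\<And>u. u \<in> D \<Longrightarrow> norm u \<le> C * norm (z *\<^sub>R u - A u)"
proof -
  obtain C where C: "\<And>u. u \<in> D \<Longrightarrow> norm u \<le> C * norm (z *\<^sub>R u - A u)"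
    using assms unfolding regular_def by blast
  have "norm u \<le> max C 1 * norm (z *\<^sub>R u - A u)" if "u \<in> D" for u
    by (rule order_trans[OF C[OF that]]) (auto intro: mult_right_mono)
  thus ?thesis using that[of "max C 1"] by simp
qed

lemma bounded_linear_R:
  assumes z: "regular z"
  shows "bounded_linear (R z)"
proof -
  obtain C where C: "C > 0" "\<And>u. u \<in> D \<Longrightarrow> norm u \<le> C * norm (z *\<^sub>R u - A u)"
    using regular_bound[OF z] by blast
  show ?thesis
  proof (rule bounded_linear_intro[of _ C])
    fix x y :: 'b and c :: real
    show "R z (x + y) = R z x + R z y"
    proof (rule R_unique[OF z])
      show "z *\<^sub>R (R z x + R z y) - A (R z x + R z y) = x + y"
        using R_eq[OF z, of x] R_eq[OF z, of y] add[OF R_in_D[OF z] R_in_D[OF z], of x y]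
        by (simp add: scaleR_add_right add_diff_add)
    qed (simp add: R_in_D[OF z])
    have "z *\<^sub>R c *\<^sub>R R z x - A (c *\<^sub>R R z x) = c *\<^sub>R (z *\<^sub>R R z x - A (R z x))"
      using R_in_D[OF z] by (simp add: scale algebra_simps)
    thus "R z (c *\<^sub>R x) = c *\<^sub>R R z x"
      using R_in_D[OF z] R_eq[OF z, of x] by (intro R_unique[OF z]) auto
    show "norm (R z x) \<le> norm x * C"
      using C(2)[OF R_in_D[OF z, of x]] R_eq[OF z] by (simp add: mult.commute)
  qed
qed

lemma R_sym:
  assumes z: "regular z"
  shows "R z x \<bullet> y = x \<bullet> R z y"
proof -
  have "R z x \<bullet> (z *\<^sub>R R z y - A (R z y)) = (z *\<^sub>R R z x - A (R z x)) \<bullet> R z y"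
    using sym[OF R_in_D[OF z, of x] R_in_D[OF z, of y]] by (simp add: inner_diff_left inner_diff_right)
  thus ?thesis by (simp add: R_eq[OF z])
qed

text \<open>Applied to \<open>R z y\<close>, the operator \<open>z + c - A\<close> gives
  \<open>c\<close> times \<open>R z y + (1 / c) *\<^sub>R y\<close>. Regularity of
  \<open>z + c\<close> thus bounds \<open>R z y\<close>, and then \<open>y\<close>; in spectral
  terms, \<open>- 1 / c\<close> is not an approximate eigenvalue of \<open>R z\<close>.\<close>

lemma R_shift_bounded_below:
  assumes z: "regular z" and zc: "regular (z + c)" and c: "c \<noteq> 0"
  shows "\<exists>K>0. \<forall>y. norm y \<le> K * norm (R z y + (1 / c) *\<^sub>R y)"
proof -
  obtain C where C: "C > 0" "\<And>u. u \<in> D \<Longrightarrow> norm u \<le> C * norm ((z + c) *\<^sub>R u - A u)"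
    using regular_bound[OF zc] by blast
  define K where "K = \<bar>c\<bar> * (1 + \<bar>c\<bar> * C)"
  have "norm y \<le> K * norm (R z y + (1 / c) *\<^sub>R y)" for y
  proof -
    define w where "w = R z y"
    define v where "v = (z + c) *\<^sub>R w - A w"
    have y: "y = v - c *\<^sub>R w" using R_eq[OF z, of y] by (simp add: w_def v_def algebra_simps)
    have v: "v = c *\<^sub>R (R z y + (1 / c) *\<^sub>R y)"
      using y c by (simp add: w_def algebra_simps)
    have "norm w \<le> C * norm v" unfolding v_def using R_in_D[OF z] by (intro C) (simp add: w_def)
    hence "\<bar>c\<bar> * norm w \<le> \<bar>c\<bar> * (C * norm v)" by (intro mult_left_mono) auto
    hence "norm y \<le> norm v + \<bar>c\<bar> * (C * norm v)"
      using norm_triangle_ineq4[of v "c *\<^sub>R w"] y by simp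
    also have "\<dots> = (1 + \<bar>c\<bar> * C) * norm v" by (simp add: algebra_simps)
    also have "norm v = \<bar>c\<bar> * norm (R z y + (1 / c) *\<^sub>R y)" by (subst v) simp
    finally show ?thesis by (simp add: K_def mult_ac)
  qed
  moreover have "K > 0" using c C unfolding K_def by (intro mult_pos_pos add_pos_nonneg) auto
  ultimately show ?thesis by blast
qed

text \<open>With \<open>B = R z\<close> and \<open>N\<close> its norm, \<open>B\<^sup>2 - N\<^sup>2\<close> is not bounded below, so the factors
  \<open>B \<plusminus> N\<close> are not both bounded below; hence one of \<open>z \<plusminus> 1 / N\<close> is a spectral value.\<close>

lemma resolvent_distance_bound:
  assumes reg: "\<And>w. \<bar>w - z\<bar> < r \<Longrightarrow> regular w" and r: "r > 0" and f: "f \<in> D"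
  shows "r * norm f \<le> norm (z *\<^sub>R f - A f)"
proof (rule ccontr)
  assume neg: "\<not> ?thesis"
  have z: "regular z" using reg r by simp
  interpret B: bounded_linear "R z" by (rule bounded_linear_R[OF z])
  define N where "N = onorm (R z)"
  have le: "norm (R z x) \<le> N * norm x" for x
    unfolding N_def by (rule onorm[OF B.bounded_linear_axioms])
  have "norm f \<le> N * norm (z *\<^sub>R f - A f)" using le[of "z *\<^sub>R f - A f"] R_unique[OF z f] by simp
  moreover have fpos: "norm f > 0" using neg r by (auto simp: scale[OF f, of 0, simplified])
  ultimately have N: "N > 0"
    by (metis less_le_trans norm_ge_zero mult_nonpos_nonneg not_less)
  \<comment> \<open>Failure of the bound forces \<open>1 / N < r\<close>, so
    \<open>z + 1 / N\<close> and \<open>z - 1 / N\<close> are both regular.\<close>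
  have "N * norm (z *\<^sub>R f - A f) < N * (r * norm f)" using neg N by simp
  hence "1 * norm f < (N * r) * norm f"
    using \<open>norm f \<le> N * _\<close> by (simp only: mult_1_left mult.assoc)
  hence "1 < N * r" using fpos by (simp only: mult_less_cancel_right_pos)
  hence cr: "\<bar>z + 1 / N - z\<bar> < r" "\<bar>z + - 1 / N - z\<bar> < r"
    using N by (simp_all add: pos_divide_less_eq mult.commute)
  have "\<exists>K>0. \<forall>y. norm y \<le> K * norm (R z y + (1 / (1 / N)) *\<^sub>R y)"
    using N by (intro R_shift_bounded_below z reg cr) simp
  then obtain K1 where K1: "K1 > 0" "\<And>y. norm y \<le> K1 * norm (R z y + N *\<^sub>R y)" by auto
  have "\<exists>K>0. \<forall>y. norm y \<le> K * norm (R z y + (1 / (- 1 / N)) *\<^sub>R y)"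
    using N by (intro R_shift_bounded_below z reg cr) simp
  then obtain K2 where K2: "K2 > 0" "\<And>y. norm y \<le> K2 * norm (R z y - N *\<^sub>R y)" by auto
  define K where "K = K2 * K1"
  have K: "K > 0" using K1 K2 by (simp add: K_def)
  \<comment> \<open>The factors \<open>R z + N\<close> and \<open>R z - N\<close> are bounded below,
    hence so is their product.\<close>
  have low: "norm x \<le> K * norm (R z (R z x) - N\<^sup>2 *\<^sub>R x)" for x
  proof -
    have "norm x \<le> K2 * norm (R z x - N *\<^sub>R x)" by (rule K2)
    also have "\<dots> \<le> K2 * (K1 * norm (R z (R z x - N *\<^sub>R x) + N *\<^sub>R (R z x - N *\<^sub>R x)))"
      using K2(1) by (intro mult_left_mono K1(2)) auto
    also have "R z (R z x - N *\<^sub>R x) + N *\<^sub>R (R z x - N *\<^sub>R x) = R z (R z x) - N\<^sup>2 *\<^sub>R x"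
      by (simp add: B.diff B.scaleR scaleR_diff_right power2_eq_square)
    finally show ?thesis by (simp add: K_def)
  qed
  \<comment> \<open>Write B for \<open>R z\<close>. Expanding the square of \<open>low\<close>, with
    <B(Bx), x> = |Bx|^2 by symmetry and |B(Bx)| \<le> N|Bx|, gives |Bx|^2 \<le> q|x|^2. As
    \<open>q\<close> is less than \<open>N\<^sup>2\<close>, this contradicts the choice of
    \<open>N\<close> as the operator norm.\<close>
  define q where "q = N\<^sup>2 - 1 / (K\<^sup>2 * N\<^sup>2)"
  have main: "(norm (R z x))\<^sup>2 \<le> q * (norm x)\<^sup>2" for x
  proof -
    have "(norm x)\<^sup>2 \<le> (K * norm (R z (R z x) - N\<^sup>2 *\<^sub>R x))\<^sup>2" by (intro power_mono low) auto
    also have "\<dots> = K\<^sup>2 * (norm (R z (R z x) - N\<^sup>2 *\<^sub>R x))\<^sup>2" by (simp add: power_mult_distrib)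
    also have "(norm (R z (R z x) - N\<^sup>2 *\<^sub>R x))\<^sup>2
       = (norm (R z (R z x)))\<^sup>2 - 2 * N\<^sup>2 * (R z (R z x) \<bullet> x) + N^4 * (norm x)\<^sup>2"
      using norm_add_scaleR_squared[of "R z (R z x)" "- N\<^sup>2" x] by simp
    also have "R z (R z x) \<bullet> x = (norm (R z x))\<^sup>2"
      by (simp add: R_sym[OF z] power2_norm_eq_inner)
    also have "(norm (R z (R z x)))\<^sup>2 \<le> N\<^sup>2 * (norm (R z x))\<^sup>2"
      using power_mono[OF le[of "R z x"], of 2] by (simp add: power_mult_distrib)
    finally have "(norm x)\<^sup>2 \<le> K\<^sup>2 * (N^4 * (norm x)\<^sup>2 - N\<^sup>2 * (norm (R z x))\<^sup>2)"
      using K by (simp add: mult_left_mono)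
    hence "(norm x)\<^sup>2 / (K\<^sup>2 * N\<^sup>2) \<le> N\<^sup>2 * (norm x)\<^sup>2 - (norm (R z x))\<^sup>2"
      using K N by (simp add: field_simps power2_eq_square power4_eq_xxxx)
    thus ?thesis by (simp add: q_def algebra_simps)
  qed
  have q0: "q \<ge> 0"
  proof -
    have "0 \<le> q * (norm f)\<^sup>2" using main[of f] by (rule order_trans[rotated]) simp
    thus ?thesis using fpos by (simp add: zero_le_mult_iff)
  qed
  have "norm (R z x) \<le> sqrt q * norm x" for x
    using real_sqrt_le_mono[OF main[of x]] by (simp add: real_sqrt_mult)
  hence "N \<le> sqrt q" unfolding N_def using q0 by (intro onorm_bound) auto
  hence "N\<^sup>2 \<le> q" using N q0 by (metis power_mono less_imp_le real_sqrt_pow2)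
  moreover have "q < N\<^sup>2" using K N by (simp add: q_def)
  ultimately show False by simp
qed

end

section \<open>Consequences of the spectral gap\<close>

text \<open>In terms of \<open>s - A\<close>, the real points that may fail to be regular are 0 and
  those in [\<delta>, \<infinity>). The inequalities below replace functional calculus on this
  set.\<close>

locale gapped_operator = symmetric_operator +
  fixes s \<delta> :: real
  assumes \<delta>: "\<delta> > 0"
    and above: "\<And>z. s < z \<Longrightarrow> regular z"
    and gap: "\<And>z. s - \<delta> < z \<Longrightarrow> z < s \<Longrightarrow> regular z"
begin

definition L :: "'a \<Rightarrow> 'a" where "L f = s *\<^sub>R f - A f"

lemma L_diff: "f \<in> D \<Longrightarrow> g \<in> D \<Longrightarrow> L (f - g) = L f - L g"
  by (simp add: L_def diff algebra_simps)

lemma L_sym: "f \<in> D \<Longrightarrow> g \<in> D \<Longrightarrow> L f \<bullet> g = f \<bullet> L g"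
  by (simp add: L_def sym inner_diff_left inner_diff_right)

lemma L_scale: "f \<in> D \<Longrightarrow> L (c *\<^sub>R f) = c *\<^sub>R L f"
  by (simp add: L_def scale algebra_simps)

text \<open>All points within distance \<open>\<mu>\<close> of \<open>s + \<mu>\<close> exceed
  \<open>s\<close>, so the distance bound applies with radius \<open>\<mu>\<close>.\<close>

lemma accretive_bound:
  assumes "\<mu> > 0" "f \<in> D"
  shows "\<mu> * norm f \<le> norm (L f + \<mu> *\<^sub>R f)"
proof -
  have "\<mu> * norm f \<le> norm ((s + \<mu>) *\<^sub>R f - A f)"
    using assms by (intro resolvent_distance_bound above) auto
  thus ?thesis by (simp add: L_def algebra_simps)
qed

text \<open>Squaring \<open>accretive_bound\<close> leaves |Lf|^2 + 2 \<mu> <Lf, f> \<ge> 0 for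
  every \<open>\<mu> > 0\<close>, which fails for large \<open>\<mu>\<close> if <Lf, f> is
  negative.\<close>

lemma L_nonneg:
  assumes f: "f \<in> D"
  shows "L f \<bullet> f \<ge> 0"
proof (rule ccontr)
  assume "\<not> ?thesis"
  hence neg: "L f \<bullet> f < 0" by simp
  \<comment> \<open>Makes the cross term equal to
    \<open>- ((norm (L f))\<^sup>2 + 1)\<close>.\<close>
  define \<mu> where "\<mu> = ((norm (L f))\<^sup>2 + 1) / (- 2 * (L f \<bullet> f))"
  have \<mu>: "\<mu> > 0" using neg unfolding \<mu>_def by (intro divide_pos_pos add_nonneg_pos) auto
  have "(\<mu> * norm f)\<^sup>2 \<le> (norm (L f + \<mu> *\<^sub>R f))\<^sup>2"
    using \<mu> by (intro power_mono accretive_bound f) auto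
  also have "\<dots> = (norm (L f))\<^sup>2 + 2 * \<mu> * (L f \<bullet> f) + (\<mu> * norm f)\<^sup>2"
    by (simp only: norm_add_scaleR_squared power_mult_distrib)
  also have "2 * \<mu> * (L f \<bullet> f) = - ((norm (L f))\<^sup>2 + 1)" using neg by (simp add: \<mu>_def field_simps)
  finally show False by simp
qed

text \<open>The distance bound at the midpoint of the gap, squared, with radius
  \<open>\<delta> / 2\<close>. Its spectral counterpart is \<delta> \<lambda> \<le> \<lambda>^2 for
  \<lambda> = 0 and for \<lambda> \<ge> \<delta>.\<close>

lemma norm_L_ge:
  assumes f: "f \<in> D"
  shows "\<delta> * (L f \<bullet> f) \<le> (norm (L f))\<^sup>2"
proof -
  have "\<delta>/2 * norm f \<le> norm ((s - \<delta>/2) *\<^sub>R f - A f)"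
  proof (intro resolvent_distance_bound gap f)
    fix w assume "\<bar>w - (s - \<delta>/2)\<bar> < \<delta>/2"
    thus "s - \<delta> < w" "w < s" unfolding abs_less_iff by linarith+
  qed (use \<delta> in simp)
  also have "(s - \<delta>/2) *\<^sub>R f - A f = L f - (\<delta>/2) *\<^sub>R f" by (simp add: L_def algebra_simps)
  finally have "(\<delta>/2 * norm f)\<^sup>2 \<le> (norm (L f - (\<delta>/2) *\<^sub>R f))\<^sup>2"
    using \<delta> by (intro power_mono) auto
  also have "\<dots> = (norm (L f))\<^sup>2 - \<delta> * (L f \<bullet> f) + (\<delta>/2 * norm f)\<^sup>2"
    using norm_add_scaleR_squared[of "L f" "- (\<delta>/2)" f] by (simp add: power_mult_distrib power_divide)
  finally show ?thesis by simp
qed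

text \<open>Expand \<open>L (f - y / \<delta>) \<bullet> (f - y / \<delta>) \<ge> 0\<close> for \<open>y = L f\<close>.\<close>

lemma L_coercive_on_range:
  assumes f: "f \<in> D" and y: "L f \<in> D"
  shows "L (L f) \<bullet> L f \<ge> \<delta> * (norm (L f))\<^sup>2"
proof -
  define y where "y = L f"
  have yD: "y \<in> D" using y by (simp add: y_def)
  define a where "a = (norm y)\<^sup>2"
  define t where "t = 1 / \<delta>"
  have a1: "L f \<bullet> y = a" by (simp add: a_def y_def power2_norm_eq_inner)
  have a2: "L y \<bullet> f = a" using L_sym[OF yD f] by (simp add: a_def y_def power2_norm_eq_inner)
  have "0 \<le> L (f - t *\<^sub>R y) \<bullet> (f - t *\<^sub>R y)" using f yD by (intro L_nonneg) simp
  also have "\<dots> = L f \<bullet> f - 2 * t * a + t\<^sup>2 * (L y \<bullet> y)"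
    using f yD a1 a2 by (simp add: L_diff L_scale inner_diff_left inner_diff_right algebra_simps power2_eq_square)
  finally have 1: "0 \<le> L f \<bullet> f - 2 * t * a + t\<^sup>2 * (L y \<bullet> y)" .
  have "L f \<bullet> f \<le> t * a" using norm_L_ge[OF f] \<delta> by (simp add: a_def y_def t_def field_simps)
  hence "t * a \<le> t\<^sup>2 * (L y \<bullet> y)" using 1 by linarith
  hence "\<delta> * a \<le> L y \<bullet> y" using \<delta> by (simp add: t_def field_simps power2_eq_square)
  thus ?thesis by (simp add: a_def y_def)
qed

text \<open>Cauchy-Schwarz turns coercivity into a lower bound for \<open>L\<close> on those vectors
  of its range that lie in \<open>D\<close>.\<close>

lemma norm_LL_ge:
  assumes f: "f \<in> D" and y: "L f \<in> D"
  shows "\<delta> * norm (L f) \<le> norm (L (L f))"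
proof (cases "L f = 0")
  case False
  have "\<delta> * norm (L f) * norm (L f) \<le> L (L f) \<bullet> L f"
    using L_coercive_on_range[OF assms] by (simp add: power2_eq_square)
  also have "\<dots> \<le> norm (L (L f)) * norm (L f)" by (rule norm_cauchy_schwarz)
  finally show ?thesis using False by simp
qed (use \<delta> in auto)

section \<open>Convergence of the scaled resolvents to the kernel projection\<close>

text \<open>This is \<mu> (\<mu> + L)^(-1), an approximation of the orthogonal projection onto the
  kernel of \<open>L\<close> for small positive \<open>\<mu>\<close>.\<close>

definition F :: "real \<Rightarrow> 'a \<Rightarrow> 'a" where "F \<mu> x = \<mu> *\<^sub>R R (s + \<mu>) x"

text \<open>By \<open>L_R\<close>, the vector \<open>x - F \<mu> x\<close> lies in the range of
  \<open>L\<close>. The contraction bound is \<open>accretive_bound\<close> at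
  \<open>F \<mu> x\<close>, where \<open>L (F \<mu> x) + \<mu> *\<^sub>R F \<mu> x\<close> equals
  \<open>\<mu> *\<^sub>R x\<close>.\<close>

lemma
  assumes \<mu>: "\<mu> > 0"
  shows F_in_D: "F \<mu> x \<in> D" and L_R: "L (R (s + \<mu>) x) = x - F \<mu> x"
    and L_F: "L (F \<mu> x) = \<mu> *\<^sub>R (x - F \<mu> x)" and norm_F: "norm (F \<mu> x) \<le> norm x"
    and bounded_linear_F: "bounded_linear (F \<mu>)"
proof -
  have reg: "regular (s + \<mu>)" using \<mu> by (intro above) simp
  note RD = R_in_D[OF reg, of x]
  show "F \<mu> x \<in> D" using RD by (simp add: F_def)
  show LR: "L (R (s + \<mu>) x) = x - F \<mu> x"
    using R_eq[OF reg, of x] by (simp add: L_def F_def algebra_simps)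
  show LF: "L (F \<mu> x) = \<mu> *\<^sub>R (x - F \<mu> x)"
    unfolding LR[symmetric] by (simp add: F_def L_scale RD)
  have "\<mu> * norm (F \<mu> x) \<le> norm (L (F \<mu> x) + \<mu> *\<^sub>R F \<mu> x)"
    using \<open>F \<mu> x \<in> D\<close> by (intro accretive_bound \<mu>)
  also have "L (F \<mu> x) + \<mu> *\<^sub>R F \<mu> x = \<mu> *\<^sub>R x" by (simp add: LF algebra_simps)
  finally show "norm (F \<mu> x) \<le> norm x" using \<mu> by simp
  show "bounded_linear (F \<mu>)" unfolding F_def
    by (intro bounded_linear_scaleR_right[THEN bounded_linear_compose] bounded_linear_R[OF reg])
qed

lemma norm_diff_F: "\<mu> > 0 \<Longrightarrow> norm (x - F \<mu> x) \<le> 2 * norm x"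
  using norm_triangle_ineq4[of x "F \<mu> x"] norm_F[of \<mu> x] by simp

text \<open>The difference is itself \<open>L h\<close> for a difference \<open>h\<close> of
  resolvents, so \<open>norm_LL_ge\<close> controls it by its image under \<open>L\<close>; by
  \<open>L_F\<close> that image has size of order \<open>\<mu> + \<nu>\<close>.\<close>

lemma F_cauchy:
  assumes "\<mu> > 0" "\<nu> > 0"
  shows "norm (F \<mu> x - F \<nu> x) \<le> 2 * norm x / \<delta> * (\<mu> + \<nu>)"
proof -
  define h where "h = R (s + \<nu>) x - R (s + \<mu>) x"
  have hD: "h \<in> D" unfolding h_def using assms by (intro D_closed R_in_D above) auto
  have Lh: "L h = F \<mu> x - F \<nu> x"
    unfolding h_def using assms by (subst L_diff) (auto intro!: R_in_D above simp: L_R)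
  have "\<delta> * norm (F \<mu> x - F \<nu> x) \<le> norm (L (F \<mu> x - F \<nu> x))"
    using norm_LL_ge[OF hD] assms by (simp add: Lh F_in_D)
  also have "L (F \<mu> x - F \<nu> x) = \<mu> *\<^sub>R (x - F \<mu> x) - \<nu> *\<^sub>R (x - F \<nu> x)"
    using assms by (simp add: L_diff F_in_D L_F)
  also have "norm \<dots> \<le> \<mu> * norm (x - F \<mu> x) + \<nu> * norm (x - F \<nu> x)"
    using assms norm_triangle_ineq4[of "\<mu> *\<^sub>R (x - F \<mu> x)" "\<nu> *\<^sub>R (x - F \<nu> x)"] by simp
  also have "\<dots> \<le> \<mu> * (2 * norm x) + \<nu> * (2 * norm x)"
    using assms by (intro add_mono mult_left_mono norm_diff_F) auto
  finally show ?thesis using \<delta> by (simp add: field_simps)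
qed

text \<open>Closedness of \<open>L\<close> at the value 0, obtained from the bounded operator
  \<open>R (s + 1)\<close>: it sends \<open>L (X n) + X n\<close> to \<open>X n\<close>, hence fixes
  the limit \<open>p\<close>.\<close>

lemma L_kernel_closed:
  assumes X: "X \<longlonglongrightarrow> p" "\<And>n. X n \<in> D" and LX: "(\<lambda>n. L (X n)) \<longlonglongrightarrow> 0"
  shows "p \<in> D" "L p = 0"
proof -
  have reg: "regular (s + 1)" by (intro above) simp
  interpret B: bounded_linear "R (s + 1)" by (rule bounded_linear_R[OF reg])
  have "R (s + 1) (L (X n) + X n) = X n" for n
    using X(2) by (intro R_unique[OF reg]) (auto simp: L_def algebra_simps)
  moreover have "(\<lambda>n. R (s + 1) (L (X n) + X n)) \<longlonglongrightarrow> R (s + 1) (0 + p)"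
    by (intro B.tendsto tendsto_add X LX)
  ultimately have p: "R (s + 1) p = p" using X(1) LIMSEQ_unique by fastforce
  show "p \<in> D" using R_in_D[OF reg, of p] by (simp add: p)
  show "L p = 0" using L_R[of 1 p] by (simp add: p F_def)
qed

end

locale complete_gapped_operator = gapped_operator D A s \<delta>
  for D :: "'b::{real_inner, complete_space} set" and A s \<delta>
begin

text \<open>Completeness gives the limit of \<open>F \<mu> x\<close>, and \<open>F_cauchy\<close>
  passes to the limit with its rate. The last property says that \<open>x - p\<close> is orthogonal
  to the kernel, so \<open>p\<close> is the orthogonal projection of \<open>x\<close>.\<close>

lemma kernel_projection:
  obtains p where "p \<in> D" "L p = 0" "\<And>\<mu>. \<mu> > 0 \<Longrightarrow> norm (F \<mu> x - p) \<le> 2 * norm x / \<delta> * \<mu>"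
    "\<And>v. v \<in> D \<Longrightarrow> L v = 0 \<Longrightarrow> p \<bullet> v = x \<bullet> v"
proof -
  define \<mu> :: "nat \<Rightarrow> real" where "\<mu> n = 1 / real (Suc n)" for n
  define X where "X n = F (\<mu> n) x" for n
  have \<mu>: "\<mu> n > 0" for n by (simp add: \<mu>_def)
  have \<mu>0: "\<mu> \<longlonglongrightarrow> 0" unfolding \<mu>_def by (rule LIMSEQ_Suc[OF lim_1_over_n])
  define M where "M = 2 * norm x / \<delta>"
  have M: "M \<ge> 0" using \<delta> by (simp add: M_def)
  have "Cauchy X"
  proof (rule metric_CauchyI)
    fix e :: real assume e: "e > 0"
    \<comment> \<open>\<open>M\<close> vanishes for \<open>x = 0\<close>; adding 1 permits
      division.\<close>
    define K where "K = M + 1"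
    have K: "K > 0" "M \<le> K" using M by (auto simp: K_def)
    have "e / (2 * K) > 0" using e K by simp
    from order_tendstoD(2)[OF \<mu>0 this] obtain n0 where n0: "\<And>n. n \<ge> n0 \<Longrightarrow> \<mu> n < e / (2 * K)"
      by (auto simp: eventually_sequentially)
    have "dist (X m) (X n) < e" if "m \<ge> n0" "n \<ge> n0" for m n
    proof -
      have "dist (X m) (X n) \<le> M * (\<mu> m + \<mu> n)"
        using F_cauchy[OF \<mu>[of m] \<mu>[of n], of x] by (simp add: X_def dist_norm M_def)
      also have "\<dots> \<le> K * (\<mu> m + \<mu> n)"
        using \<mu>[of m] \<mu>[of n] K by (intro mult_right_mono) auto
      also have "\<dots> < K * (e / (2 * K) + e / (2 * K))"
        using K n0[OF that(1)] n0[OF that(2)] by (intro mult_strict_left_mono add_strict_mono) auto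
      also have "\<dots> = e" using K by (simp add: field_simps)
      finally show ?thesis .
    qed
    thus "\<exists>M. \<forall>m\<ge>M. \<forall>n\<ge>M. dist (X m) (X n) < e" by blast
  qed
  then obtain p where p: "X \<longlonglongrightarrow> p" using Cauchy_convergent convergent_def by blast
  have XD: "X n \<in> D" for n by (simp add: X_def F_in_D \<mu>)
  have "(\<lambda>n. \<mu> n *\<^sub>R (x - X n)) \<longlonglongrightarrow> 0 *\<^sub>R (x - p)" by (intro tendsto_intros \<mu>0 p)
  hence LX: "(\<lambda>n. L (X n)) \<longlonglongrightarrow> 0" by (simp add: X_def L_F \<mu>)
  have est: "norm (F \<nu> x - p) \<le> M * \<nu>" if "\<nu> > 0" for \<nu>
  proof (rule LIMSEQ_le)
    show "(\<lambda>n. norm (F \<nu> x - X n)) \<longlonglongrightarrow> norm (F \<nu> x - p)" by (intro tendsto_intros p)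
    have "(\<lambda>n. M * (\<nu> + \<mu> n)) \<longlonglongrightarrow> M * (\<nu> + 0)" by (intro tendsto_intros \<mu>0)
    thus "(\<lambda>n. M * (\<nu> + \<mu> n)) \<longlonglongrightarrow> M * \<nu>" by simp
    show "\<exists>N. \<forall>n\<ge>N. norm (F \<nu> x - X n) \<le> M * (\<nu> + \<mu> n)"
      using F_cauchy[OF that \<mu>] by (auto simp: X_def M_def)
  qed
  have inn: "p \<bullet> v = x \<bullet> v" if "v \<in> D" "L v = 0" for v
  proof -
    \<comment> \<open>By symmetry, \<open>\<mu> n\<close> times <x - X n, v> is <L (X n), v> = <X n,
      L v> = 0.\<close>
    have "X n \<bullet> v = x \<bullet> v" for n
      using L_sym[OF XD that(1), of n] that(2) \<mu>[of n] by (auto simp: X_def L_F \<mu> inner_diff_left)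
    moreover have "(\<lambda>n. X n \<bullet> v) \<longlonglongrightarrow> p \<bullet> v" by (intro tendsto_intros p)
    ultimately show ?thesis by (simp add: LIMSEQ_const_iff)
  qed
  show ?thesis
    using that[OF L_kernel_closed[OF p XD LX]] est inn by (auto simp: M_def)
qed

end

section \<open>Growth and decay of the semigroup\<close>

locale gapped_semigroup = gapped_operator +
  fixes T :: "real \<Rightarrow> 'a \<Rightarrow> 'a"
  assumes T_bl: "\<And>t. t \<ge> 0 \<Longrightarrow> bounded_linear (T t)"
    and T_0: "\<And>f. T 0 f = f"
    and T_add: "\<And>t r f. t \<ge> 0 \<Longrightarrow> r \<ge> 0 \<Longrightarrow> T (t + r) f = T t (T r f)"
    and T_cont: "\<And>f. continuous_on {0..} (\<lambda>t. T t f)"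
    and D_eq: "D = {f. \<exists>g. ((\<lambda>h. (1 / h) *\<^sub>R (T h f - f)) \<longlongrightarrow> g) (at_right 0)}"
    and T_gen: "\<And>f. f \<in> D \<Longrightarrow> ((\<lambda>h. (1 / h) *\<^sub>R (T h f - f)) \<longlongrightarrow> A f) (at_right 0)"
    and dense: "closure D = UNIV"
begin

text \<open>The bounded operator \<open>T t\<close> commutes with the difference quotients, so those
  at \<open>T t f\<close> converge to \<open>T t (A f)\<close>; by \<open>D_eq\<close>, such
  convergence is membership in \<open>D\<close>.\<close>

lemma
  assumes t: "t \<ge> 0" and f: "f \<in> D"
  shows T_in_D: "T t f \<in> D" and A_T: "A (T t f) = T t (A f)"
proof -
  interpret B: bounded_linear "T t" by (rule T_bl[OF t])
  have "((\<lambda>h. T t ((1 / h) *\<^sub>R (T h f - f))) \<longlongrightarrow> T t (A f)) (at_right 0)"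
    by (intro B.tendsto T_gen f)
  moreover have "\<forall>\<^sub>F h in at_right 0. T t ((1 / h) *\<^sub>R (T h f - f)) = (1 / h) *\<^sub>R (T h (T t f) - T t f)"
    unfolding eventually_at_right_field
  proof (intro exI[of _ 1] conjI allI impI)
    fix h :: real assume "0 < h" "h < 1"
    hence "T t (T h f) = T h (T t f)" using t T_add[of t h f] T_add[of h t f] by (simp add: add.commute)
    thus "T t ((1 / h) *\<^sub>R (T h f - f)) = (1 / h) *\<^sub>R (T h (T t f) - T t f)"
      by (simp add: B.scaleR B.diff)
  qed simp
  ultimately have lim: "((\<lambda>h. (1 / h) *\<^sub>R (T h (T t f) - T t f)) \<longlongrightarrow> T t (A f)) (at_right 0)"
    by (rule Lim_transform_eventually)
  thus D: "T t f \<in> D" by (subst D_eq) auto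
  show "A (T t f) = T t (A f)"
    by (rule tendsto_unique[OF _ T_gen[OF D] lim]) simp
qed

lemma T_right_derivative:
  assumes t: "t \<ge> 0" and f: "f \<in> D"
  shows "((\<lambda>t. T t f) has_vector_derivative A (T t f)) (at_right t)"
proof -
  have "((\<lambda>h. (1 / h) *\<^sub>R (T h (T t f) - T t f)) \<longlongrightarrow> A (T t f)) (at_right 0)"
    by (rule T_gen[OF T_in_D[OF t f]])
  moreover have "\<forall>\<^sub>F h in at_right 0. (1 / h) *\<^sub>R (T h (T t f) - T t f) = (1 / h) *\<^sub>R (T (h + t) f - T t f)"
    unfolding eventually_at_right_field
    by (intro exI[of _ 1]) (auto simp: T_add t)
  ultimately have "((\<lambda>h. (1 / h) *\<^sub>R (T (h + t) f - T t f)) \<longlongrightarrow> A (T t f)) (at_right 0)"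
    by (rule Lim_transform_eventually)
  hence "((\<lambda>x. (1 / (x - t)) *\<^sub>R (T x f - T t f)) \<longlongrightarrow> A (T t f)) (at_right t)"
    by (subst at_right_to_0) (simp add: filterlim_filtermap)
  hence "((\<lambda>x. (1 / (x - t)) *\<^sub>R (T x f - T t f) - A (T t f)) \<longlongrightarrow> 0) (at_right t)"
    by (rule LIM_zero)
  moreover have "\<forall>\<^sub>F x in at_right t. (1 / (x - t)) *\<^sub>R (T x f - T t f) - A (T t f)
      = (T x f - T t f - (x - t) *\<^sub>R A (T t f)) /\<^sub>R norm (x - t)"
    unfolding eventually_at_right_field
    by (intro exI[of _ "t + 1"]) (auto simp: scaleR_diff_right divide_inverse)
  ultimately have "((\<lambda>x. (T x f - T t f - (x - t) *\<^sub>R A (T t f)) /\<^sub>R norm (x - t)) \<longlongrightarrow> 0) (at_right t)"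
    by (rule Lim_transform_eventually)
  thus ?thesis
    by (simp add: has_vector_derivative_def has_derivative_at_within bounded_linear_scaleR_left)
qed

text \<open>Used with \<open>k = 0\<close> on all of \<open>D\<close> and with
  \<open>k = \<delta>\<close> on vectors of the range of \<open>L\<close>.\<close>

lemma T_growth:
  assumes f: "f \<in> D" and t: "t \<ge> 0"
    and k: "\<And>r. r \<ge> 0 \<Longrightarrow> L (T r f) \<bullet> T r f \<ge> k * (norm (T r f))\<^sup>2"
  shows "norm (T t f) \<le> exp ((s - k) * t) * norm f"
proof -
  have "norm (T t f) \<le> exp ((s - k) * t) * norm (T 0 f)"
  proof (rule norm_le_exp_of_dissipative[OF T_cont T_right_derivative[OF _ f] _ t])
    fix r :: real assume "r \<ge> 0"
    from k[OF this] show "A (T r f) \<bullet> T r f \<le> (s - k) * (norm (T r f))\<^sup>2"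
      by (simp add: L_def inner_diff_left power2_norm_eq_inner algebra_simps)
  qed
  thus ?thesis by (simp add: T_0)
qed

lemma norm_T:
  assumes t: "t \<ge> 0"
  shows "norm (T t f) \<le> exp (s * t) * norm f"
proof -
  interpret B: bounded_linear "T t" by (rule T_bl[OF t])
  \<comment> \<open>Both sides are continuous in \<open>f\<close>, so density extends the bound from
    \<open>D\<close>.\<close>
  have "closed {f. norm (T t f) \<le> exp (s * t) * norm f}"
    by (intro closed_Collect_le continuous_intros B.continuous_on)
  moreover have "D \<subseteq> {f. norm (T t f) \<le> exp (s * t) * norm f}"
    using T_growth[of _ t 0] t by (auto intro: L_nonneg T_in_D)
  ultimately have "closure D \<subseteq> {f. norm (T t f) \<le> exp (s * t) * norm f}"
    by (rule closure_minimal[rotated])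
  thus ?thesis by (auto simp: dense)
qed

text \<open>\<open>T r\<close> commutes with \<open>L\<close>, so the orbit of
  \<open>x - F \<mu> x\<close> stays in the range of \<open>L\<close>, where \<open>L\<close> is
  coercive with constant \<open>\<delta>\<close>. Density removes the restriction to
  \<open>x\<close> in \<open>D\<close>.\<close>

lemma T_range_decay:
  assumes t: "t \<ge> 0" and \<mu>: "\<mu> > 0"
  shows "norm (T t (x - F \<mu> x)) \<le> exp ((s - \<delta>) * t) * norm (x - F \<mu> x)"
proof -
  interpret B: bounded_linear "T t" by (rule T_bl[OF t])
  interpret F: bounded_linear "F \<mu>" by (rule bounded_linear_F[OF \<mu>])
  let ?S = "{x. norm (T t (x - F \<mu> x)) \<le> exp ((s - \<delta>) * t) * norm (x - F \<mu> x)}"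
  have "closed ?S"
    by (intro closed_Collect_le continuous_intros B.continuous_on F.continuous_on)
  moreover have "D \<subseteq> ?S"
  proof clarify
    fix x assume x: "x \<in> D"
    have RD: "R (s + \<mu>) x \<in> D" using \<mu> by (intro R_in_D above) simp
    \<comment> \<open>Coercivity needs vectors of the range that also lie in \<open>D\<close>; this
      is why \<open>x\<close> starts in \<open>D\<close>.\<close>
    have yD: "x - F \<mu> x \<in> D" using x by (simp add: F_in_D \<mu>)
    show "norm (T t (x - F \<mu> x)) \<le> exp ((s - \<delta>) * t) * norm (x - F \<mu> x)"
    proof (rule T_growth[OF yD t])
      fix r :: real assume r: "r \<ge> 0"
      interpret Br: bounded_linear "T r" by (rule T_bl[OF r])
      have "L (T r (R (s + \<mu>) x)) = T r (L (R (s + \<mu>) x))"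
        by (simp add: L_def A_T[OF r RD] Br.diff Br.scaleR)
      also have "\<dots> = T r (x - F \<mu> x)" by (simp add: L_R \<mu>)
      finally have "L (T r (R (s + \<mu>) x)) = T r (x - F \<mu> x)" .
      from L_coercive_on_range[OF T_in_D[OF r RD], unfolded this, OF T_in_D[OF r yD]]
      show "\<delta> * (norm (T r (x - F \<mu> x)))\<^sup>2 \<le> L (T r (x - F \<mu> x)) \<bullet> T r (x - F \<mu> x)" .
    qed
  qed
  ultimately have "closure D \<subseteq> ?S" by (rule closure_minimal[rotated])
  thus ?thesis by (auto simp: dense)
qed

text \<open>The difference \<open>w\<close> of the two sides solves w' = s w with
  \<open>w 0 = 0\<close>, so the growth estimate forces it to vanish.\<close>

lemma T_kernel:
  assumes t: "t \<ge> 0" and p: "p \<in> D" "L p = 0"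
  shows "T t p = exp (s * t) *\<^sub>R p"
proof -
  define w where "w t = T t p - exp (s * t) *\<^sub>R p" for t
  have Ap: "A p = s *\<^sub>R p" using p(2) by (simp add: L_def)
  have "norm (w t) \<le> exp (s * t) * norm (w 0)"
  proof (rule norm_le_exp_of_dissipative[OF _ _ _ t])
    show "continuous_on {0..} w" unfolding w_def by (intro continuous_intros T_cont)
    fix r :: real assume r: "r \<ge> 0"
    interpret Br: bounded_linear "T r" by (rule T_bl[OF r])
    have "(w has_vector_derivative A (T r p) - (s * exp (s * r)) *\<^sub>R p) (at_right r)"
      unfolding w_def by (intro has_vector_derivative_diff T_right_derivative r p)
         (auto intro!: derivative_eq_intros)
    also have "A (T r p) - (s * exp (s * r)) *\<^sub>R p = s *\<^sub>R w r"
      by (simp add: A_T[OF r p(1)] Ap Br.scaleR w_def algebra_simps)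
    finally show "(w has_vector_derivative s *\<^sub>R w r) (at_right r)" .
    show "s *\<^sub>R w r \<bullet> w r \<le> s * (norm (w r))\<^sup>2" by (simp add: power2_norm_eq_inner)
  qed
  thus ?thesis by (simp add: w_def T_0)
qed

end

section \<open>Complexification and positivity of inner products\<close>

lemma cscale_of_real: "cscale (complex_of_real c) f = c *\<^sub>R f"
  by (simp add: cscale_def prod_eq_iff)

lemma Re_cinner: "Re (cinner f g) = f \<bullet> g"
  by (simp add: cinner_def inner_prod_def)

text \<open>The modulus of \<open>a - b\<close> is at most \<open>a + b\<close>, so the lattice norm
  gives |a - b| \<le> |a + b|; the squares of these norms differ by four times the inner
  product.\<close>

lemma inner_nonneg_of_lattice_norm:
  fixes a b :: "'a::{real_inner, ordered_real_vector, lattice}"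
  assumes lattice_norm: "\<And>x y::'a. sup x (- x) \<le> sup y (- y) \<Longrightarrow> norm x \<le> norm y"
    and "0 \<le> a" "0 \<le> b"
  shows "0 \<le> a \<bullet> b"
proof -
  have "a - b \<le> a + b" "b - a \<le> a + b" using assms(2,3)
    by (metis add_increasing2 diff_le_eq add.assoc add_increasing order_refl add.commute)+
  hence "sup (a - b) (- (a - b)) \<le> sup (a + b) (- (a + b))" by (simp add: le_supI1)
  hence "norm (a - b) \<le> norm (a + b)" by (rule lattice_norm)
  hence "(norm (a - b))\<^sup>2 \<le> (norm (a + b))\<^sup>2" by (intro power_mono) auto
  thus ?thesis by (simp add: power2_norm_eq_inner inner_diff_left inner_diff_right inner_add_left inner_add_right inner_commute)
qed

section \<open>Transfer to the given operator and the final estimates\<close>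

theorem theorem9p4:
  fixes D :: "('a::{real_inner, complete_space, ordered_real_vector, lattice} \<times> 'a) set"
    and A :: "'a \<times> 'a \<Rightarrow> 'a \<times> 'a"
    and T :: "real \<Rightarrow> 'a \<times> 'a \<Rightarrow> 'a \<times> 'a"
    and s :: real
  assumes lattice_norm: "\<And>x y::'a. sup x (- x) \<le> sup y (- y) \<Longrightarrow> norm x \<le> norm y"
    and lin: "clinear_op D A"
    and dense: "closure D = UNIV"
    and sa: "self_adjoint_op D A"
    and sb: "spectral_bound D A = ereal s"
    and isolated: "complex_of_real s \<in> spectrum_op D A"
        "\<not> complex_of_real s islimpt spectrum_op D A"
    and kernel_dim: "one_dimensional (eigenspace_op D A (complex_of_real s))"
    and kernel_pos: "\<exists>u\<in>eigenspace_op D A (complex_of_real s). u \<in> pos_cone \<and> u \<noteq> 0"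
    and gen: "generates T D A"
  shows "resolvent_unif_asym_pos D A s \<and> semigroup_unif_asym_pos T s"
proof -
  have symop: "symmetric_operator D A"
  proof
    show "subspace D" using lin unfolding clinear_op_def complex_subspace_def subspace_def
      by (metis cscale_of_real)
    show "A (f + g) = A f + A g" if "f \<in> D" "g \<in> D" for f g
      using lin that by (auto simp: clinear_op_def)
    show "A (c *\<^sub>R f) = c *\<^sub>R A f" if "f \<in> D" for c f
      using lin that unfolding clinear_op_def by (metis cscale_of_real)
    show "A f \<bullet> g = f \<bullet> A g" if "f \<in> D" "g \<in> D" for f g
      using sa that unfolding self_adjoint_op_def by (metis Re_cinner)
  qed
  interpret symmetric_operator D A by (rule symop)
  have rs: "complex_of_real z \<in> resolvent_set D A \<longleftrightarrow> regular z" for z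
    by (simp add: resolvent_set_def regular_def cscale_of_real)
  have rR: "resolvent D A (complex_of_real z) = R z" for z
    by (simp add: resolvent_def R_def cscale_of_real fun_eq_iff)
  have above: "regular z" if "s < z" for z
  proof (rule ccontr)
    assume "\<not> regular z"
    hence "complex_of_real z \<in> spectrum_op D A" using rs by (auto simp: spectrum_op_def)
    hence "ereal (Re (complex_of_real z)) \<le> spectral_bound D A"
      unfolding spectral_bound_def by (rule SUP_upper)
    thus False using sb that by simp
  qed
  \<comment> \<open>Isolation gives an open disc of radius \<open>\<delta>\<close> about
    \<open>s\<close> with no other spectral point; its real points left of \<open>s\<close> form the
    gap.\<close>
  obtain \<delta> where \<delta>: "\<delta> > 0"
    and iso: "\<And>z. z \<in> spectrum_op D A \<Longrightarrow> z \<noteq> complex_of_real s \<Longrightarrow> \<delta> \<le> dist z (complex_of_real s)"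
    using isolated(2) unfolding islimpt_approachable by (meson not_less)
  have gap: "regular z" if "s - \<delta> < z" "z < s" for z
  proof (rule ccontr)
    assume "\<not> regular z"
    hence "complex_of_real z \<in> spectrum_op D A" using rs by (auto simp: spectrum_op_def)
    from iso[OF this] that have "\<delta> \<le> norm (complex_of_real z - complex_of_real s)" by (simp add: dist_norm)
    also have "\<dots> = \<bar>z - s\<bar>" by (metis norm_of_real of_real_diff)
    finally show False using that by simp
  qed
  interpret complete_gapped_operator D A s \<delta>
    by unfold_locales (rule \<delta>, erule above, erule gap)
  interpret gapped_semigroup D A s \<delta> T
  proof (intro gapped_semigroup.intro gapped_semigroup_axioms.intro)
    have C0: "C0_semigroup T" using gen by (simp add: generates_def)
    show "bounded_linear (T t)" if "t \<ge> 0" for t using C0 that by (simp add: C0_semigroup_def)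
    show "T 0 f = f" for f using C0 by (simp add: C0_semigroup_def)
    show "T (t + r) f = T t (T r f)" if "t \<ge> 0" "r \<ge> 0" for t r f
      using C0 that by (simp add: C0_semigroup_def)
    show "continuous_on {0..} (\<lambda>t. T t f)" for f using C0 unfolding C0_semigroup_def by blast
    show "D = {f. \<exists>g. ((\<lambda>h. (1 / h) *\<^sub>R (T h f - f)) \<longlongrightarrow> g) (at_right 0)}"
      using gen unfolding generates_def by blast
    show "((\<lambda>h. (1 / h) *\<^sub>R (T h f - f)) \<longlongrightarrow> A f) (at_right 0)" if "f \<in> D" for f
      using gen that unfolding generates_def by blast
  qed (rule gapped_operator_axioms dense)+
  obtain u where u: "u \<in> eigenspace_op D A (complex_of_real s)" "u \<in> pos_cone" "u \<noteq> 0"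
    using kernel_pos by auto
  have ker: "v \<in> eigenspace_op D A (complex_of_real s) \<longleftrightarrow> v \<in> D \<and> L v = 0" for v
    by (auto simp: eigenspace_op_def cscale_of_real L_def)
  define u1 where "u1 = fst u"
  have u1: "u = (u1, 0)" "0 \<le> u1" "u1 \<noteq> 0"
    using u by (auto simp: pos_cone_def u1_def prod_eq_iff)
  \<comment> \<open>One-dimensionality lets the positive vector \<open>u\<close> replace the given
    spanning vector.\<close>
  have span: "eigenspace_op D A (complex_of_real s) = range (\<lambda>c. cscale c u)"
  proof -
    obtain v where v: "v \<noteq> 0" "eigenspace_op D A (complex_of_real s) = range (\<lambda>c. cscale c v)"
      using kernel_dim by (auto simp: one_dimensional_def)
    have mult: "cscale a (cscale b v) = cscale (a * b) v" for a b
      by (simp add: cscale_def algebra_simps)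
    obtain c where c: "u = cscale c v" using u v by auto
    have "c \<noteq> 0" using c u(3) by (auto simp: cscale_def prod_eq_iff)
    hence "cscale b v = cscale (b / c) u" for b by (simp add: c mult)
    hence "range (\<lambda>c. cscale c v) \<subseteq> range (\<lambda>c. cscale c u)" by blast
    moreover have "cscale b u = cscale (b * c) v" for b by (simp add: c mult)
    hence "range (\<lambda>c. cscale c u) \<subseteq> range (\<lambda>c. cscale c v)" by blast
    ultimately show ?thesis unfolding v(2) by (rule equalityI)
  qed
  \<comment> \<open>Write \<open>p\<close> as \<open>cscale c u\<close>. Testing against
    \<open>cscale \<i> u\<close>, which is orthogonal to real vectors, gives
    \<open>Im c = 0\<close>; testing against \<open>u\<close> gives
    \<open>Re c \<ge> 0\<close>.\<close>
  have proj_pos: "p \<in> pos_cone"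
    if p: "p \<in> D" "L p = 0" "\<And>v. v \<in> D \<Longrightarrow> L v = 0 \<Longrightarrow> p \<bullet> v = x \<bullet> v" and x: "x \<in> pos_cone" for p x
  proof -
    obtain c where c: "p = cscale c u" using p(1,2) ker[of p] unfolding span by blast
    have p': "p = (Re c *\<^sub>R u1, Im c *\<^sub>R u1)" by (simp add: c u1 cscale_def)
    have "cscale \<i> u \<in> eigenspace_op D A (complex_of_real s)" unfolding span by blast
    hence "p \<bullet> cscale \<i> u = x \<bullet> cscale \<i> u" unfolding ker by (intro p(3)) auto
    hence "Im c * (u1 \<bullet> u1) = 0" using x by (simp add: p' u1 cscale_def inner_prod_def pos_cone_def)
    hence "Im c = 0" using u1 by simp
    have "p \<bullet> u = x \<bullet> u" using u(1) unfolding ker by (intro p(3)) auto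
    hence "Re c * (u1 \<bullet> u1) = fst x \<bullet> u1" by (simp add: p' u1 inner_prod_def)
    also have "\<dots> \<ge> 0" using x u1 by (intro inner_nonneg_of_lattice_norm lattice_norm) (auto simp: pos_cone_def)
    finally have "Re c * (norm u1)\<^sup>2 \<ge> 0" by (simp only: power2_norm_eq_inner)
    hence "Re c \<ge> 0" using u1(3) by (simp add: zero_le_mult_iff)
    thus ?thesis using \<open>Im c = 0\<close> u1 by (simp add: p' pos_cone_def scaleR_nonneg_nonneg)
  qed
  have d_plus_le: "d_plus x \<le> norm (x - p)" if "p \<in> pos_cone" for x p :: "'a \<times> 'a"
    unfolding d_plus_def dist_norm[symmetric] by (rule infdist_le[OF that])
  have cone: "c *\<^sub>R p \<in> pos_cone" if "c \<ge> 0" "p \<in> pos_cone" for c and p :: "'a \<times> 'a"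
    using that by (auto simp: pos_cone_def scaleR_nonneg_nonneg)
  have res_est: "\<mu> * d_plus (R (s + \<mu>) x) \<le> 2 * norm x / \<delta> * \<mu>" if \<mu>: "\<mu> > 0" and x: "x \<in> pos_cone" for \<mu> x
  proof -
    obtain p where p: "p \<in> D" "L p = 0" "\<And>\<mu>. \<mu> > 0 \<Longrightarrow> norm (F \<mu> x - p) \<le> 2 * norm x / \<delta> * \<mu>"
      "\<And>v. v \<in> D \<Longrightarrow> L v = 0 \<Longrightarrow> p \<bullet> v = x \<bullet> v" using kernel_projection[of x] by blast
    \<comment> \<open>The competitor in the cone is \<open>p\<close> rescaled by
      \<open>1 / \<mu>\<close>, so that multiplication by \<open>\<mu>\<close> produces
      \<open>F \<mu> x - p\<close>.\<close>
    have "(1 / \<mu>) *\<^sub>R p \<in> pos_cone" using \<mu> by (intro cone proj_pos[OF p(1,2,4) x]) auto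
    hence "\<mu> * d_plus (R (s + \<mu>) x) \<le> \<mu> * norm (R (s + \<mu>) x - (1 / \<mu>) *\<^sub>R p)"
      using \<mu> by (intro mult_left_mono d_plus_le) auto
    also have "\<dots> = norm (\<mu> *\<^sub>R (R (s + \<mu>) x - (1 / \<mu>) *\<^sub>R p))" using \<mu> by simp
    also have "\<mu> *\<^sub>R (R (s + \<mu>) x - (1 / \<mu>) *\<^sub>R p) = F \<mu> x - p" using \<mu> by (simp add: F_def algebra_simps)
    finally show ?thesis using p(3)[OF \<mu>] by linarith
  qed
  have sg_est: "d_plus (exp (- s * t) *\<^sub>R T t x) \<le> 2 * exp (- \<delta> * t) * norm x"
    if t: "t \<ge> 0" and x: "x \<in> pos_cone" for t x
  proof -
    interpret B: bounded_linear "T t" by (rule T_bl[OF t])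
    obtain p where p: "p \<in> D" "L p = 0" "\<And>\<mu>. \<mu> > 0 \<Longrightarrow> norm (F \<mu> x - p) \<le> 2 * norm x / \<delta> * \<mu>"
      "\<And>v. v \<in> D \<Longrightarrow> L v = 0 \<Longrightarrow> p \<bullet> v = x \<bullet> v" using kernel_projection[of x] by blast
    have lim0: "((\<lambda>\<mu>. 2 * norm x / \<delta> * \<mu>) \<longlongrightarrow> 0) (at_right 0)"
      using \<delta> by (auto intro!: tendsto_eq_intros)
    \<comment> \<open>Decay is known for \<open>x - F \<mu> x\<close>. The bound does not depend on
      \<open>\<mu>\<close>, so it passes to \<open>x - p\<close> as \<open>\<mu>\<close> tends to
      0.\<close>
    have bound: "norm (T t (x - F \<mu> x)) \<le> exp ((s - \<delta>) * t) * (2 * norm x)" if "\<mu> > 0" for \<mu>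
      by (rule order_trans[OF T_range_decay[OF t that]]) (auto intro: norm_diff_F that)
    have "\<forall>\<^sub>F \<mu> in at_right 0. norm (F \<mu> x - p) \<le> 2 * norm x / \<delta> * \<mu>"
      by (rule eventually_mono[OF eventually_at_right_less]) (rule p(3))
    hence "((\<lambda>\<mu>. F \<mu> x - p) \<longlongrightarrow> 0) (at_right 0)" by (rule Lim_null_comparison[OF _ lim0])
    hence "((\<lambda>\<mu>. F \<mu> x) \<longlongrightarrow> p) (at_right 0)" by (rule LIM_zero_cancel)
    hence "((\<lambda>\<mu>. norm (T t (x - F \<mu> x))) \<longlongrightarrow> norm (T t (x - p))) (at_right 0)"
      by (intro tendsto_intros B.tendsto)
    moreover have "\<forall>\<^sub>F \<mu> in at_right 0. norm (T t (x - F \<mu> x)) \<le> exp ((s - \<delta>) * t) * (2 * norm x)"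
      by (rule eventually_mono[OF eventually_at_right_less]) (rule bound)
    ultimately have "norm (T t (x - p)) \<le> exp ((s - \<delta>) * t) * (2 * norm x)"
      by (rule tendsto_upperbound) simp
    hence 1: "exp (- s * t) * norm (T t (x - p)) \<le> exp (- s * t) * (exp ((s - \<delta>) * t) * (2 * norm x))"
      by (intro mult_left_mono) auto
    \<comment> \<open>The rescaled semigroup fixes \<open>p\<close>, so \<open>p\<close> serves as
      the point of the cone at every time.\<close>
    have "exp (- s * t) *\<^sub>R T t (x - p) = exp (- s * t) *\<^sub>R T t x - p"
      by (simp add: B.diff T_kernel[OF t p(1,2)] scaleR_diff_right exp_minus)
    hence "exp (- s * t) * norm (T t (x - p)) = norm (exp (- s * t) *\<^sub>R T t x - p)"
      by (metis norm_scaleR abs_exp_cancel)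
    moreover have "exp (- s * t) * (exp ((s - \<delta>) * t) * (2 * norm x)) = 2 * exp (- \<delta> * t) * norm x"
      by (simp add: exp_minus exp_diff left_diff_distrib field_simps)
    ultimately show ?thesis using 1 d_plus_le[OF proj_pos[OF p(1,2,4) x], of "exp (- s * t) *\<^sub>R T t x"] by linarith
  qed
  have "resolvent_unif_asym_pos D A s"
    unfolding resolvent_unif_asym_pos_def rs rR
  proof (intro conjI allI impI)
    show "complex_of_real s \<in> spectrum_op D A" by (rule isolated)
    show "\<exists>\<epsilon>>0. \<forall>l\<in>{s<..s + \<epsilon>}. regular l" by (intro exI[of _ 1]) (auto intro: above)
    have "onorm (\<lambda>f. (l - s) *\<^sub>R R l f) \<le> 1" if "l > s" for l
      using norm_F[of "l - s"] that by (intro onorm_bound) (auto simp: F_def)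
    hence "\<forall>\<^sub>F l in at_right s. ereal (onorm (\<lambda>f. (l - s) *\<^sub>R R l f)) \<le> 1"
      by (auto simp: eventually_at_right_field intro!: exI[of _ "s + 1"])
    hence "Limsup (at_right s) (\<lambda>l. ereal (onorm (\<lambda>f. (l - s) *\<^sub>R R l f))) \<le> 1"
      by (rule Limsup_bounded)
    thus "Limsup (at_right s) (\<lambda>l. ereal (onorm (\<lambda>f. (l - s) *\<^sub>R R l f))) < \<infinity>"
      by (rule le_less_trans) simp
    fix \<epsilon> :: real assume \<epsilon>: "\<epsilon> > 0"
    \<comment> \<open>The endpoint of the interval cancels the constant \<open>2 / \<delta>\<close>
      of \<open>res_est\<close>.\<close>
    have "(l - s) * d_plus (R l f) \<le> \<epsilon> * norm f"
      if f: "f \<in> pos_cone" and l: "l \<in> {s<..s + \<epsilon> * \<delta> / 2}" for f l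
    proof -
      have "(l - s) * d_plus (R l f) \<le> 2 * norm f / \<delta> * (l - s)" using res_est[of "l - s" f] f l by simp
      also have "\<dots> \<le> 2 * norm f / \<delta> * (\<epsilon> * \<delta> / 2)" using l \<delta> by (intro mult_left_mono) auto
      also have "\<dots> = \<epsilon> * norm f" using \<delta> by simp
      finally show ?thesis .
    qed
    thus "\<exists>l1>s. (\<forall>l\<in>{s<..l1}. regular l) \<and>
          (\<forall>f\<in>pos_cone. \<forall>l\<in>{s<..l1}. (l - s) * d_plus (R l f) \<le> \<epsilon> * norm f)"
      using \<epsilon> \<delta> by (intro exI[of _ "s + \<epsilon> * \<delta> / 2"]) (auto intro: above)
  qed
  moreover have "semigroup_unif_asym_pos T s"
    unfolding semigroup_unif_asym_pos_def
  proof (intro conjI allI impI)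
    have "onorm (\<lambda>f. exp (- s * t) *\<^sub>R T t f) \<le> 1" if t: "t \<ge> 0" for t
    proof (intro onorm_bound)
      fix f
      have "exp (- s * t) * norm (T t f) \<le> exp (- s * t) * (exp (s * t) * norm f)"
        by (intro mult_left_mono norm_T t) auto
      also have "\<dots> = norm f" by (simp add: exp_minus field_simps)
      finally show "norm (exp (- s * t) *\<^sub>R T t f) \<le> 1 * norm f" by simp
    qed simp
    thus "\<exists>M. \<forall>t\<ge>0. onorm (\<lambda>f. exp (- s * t) *\<^sub>R T t f) \<le> M" by blast
    fix \<epsilon> :: real assume \<epsilon>: "\<epsilon> > 0"
    \<comment> \<open>Solves \<open>2 * exp (- \<delta> * t) = \<epsilon>\<close>, cut off at 0 when
      the solution is negative.\<close>
    define t0 where "t0 = max 0 (- ln (\<epsilon> / 2) / \<delta>)"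
    have "d_plus (exp (- s * t) *\<^sub>R T t f) \<le> \<epsilon> * norm f" if t: "t \<ge> t0" and f: "f \<in> pos_cone" for t f
    proof -
      have "- ln (\<epsilon> / 2) / \<delta> \<le> t" "0 \<le> t" using t by (auto simp: t0_def)
      hence "- \<delta> * t \<le> ln (\<epsilon> / 2)" using \<delta> by (simp add: field_simps)
      hence "exp (- \<delta> * t) \<le> \<epsilon> / 2" using \<epsilon> by (subst (asm) ln_ge_iff) auto
      hence "2 * exp (- \<delta> * t) * norm f \<le> \<epsilon> * norm f" by (intro mult_right_mono) auto
      thus ?thesis using sg_est[OF \<open>0 \<le> t\<close> f] by linarith
    qed
    thus "\<exists>t0\<ge>0. \<forall>t\<ge>t0. \<forall>f\<in>pos_cone. d_plus (exp (- s * t) *\<^sub>R T t f) \<le> \<epsilon> * norm f"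
      by (intro exI[of _ t0]) (auto simp: t0_def)
  qed
  ultimately show ?thesis ..
qed

end
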